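(* Let $L\subseteq\Sigma^*$ be a regular language whose syntactic monoid $\mathrm{Syn}(L)$ is a cyclic group. Then $\mathrm{ns}(L)=\mathrm{nsyn}(L)$.
   Context: $\mathrm{Syn}(L)$ is $\Sigma^*$ modulo $v\equiv_L w\iff\forall x,y\,(xvy\in L\Leftrightarrow xwy\in L)$. $\mathrm{ns}(L)$ is the least number of states of an nfa (several initial states allowed) accepting $L$. $\mathrm{nsyn}(L)$ is the least degree $|J(S)|$ (number of join-irreducibles of a finite semilattice $S$) of a boolean representation $\rho\colon\mathrm{Syn}(L)\to\mathbf{JSL}(S,S)$ (a monoid morphism into the join-preserving endomaps of $S$, multiplication $f\cdot g=g\circ f$) which extends the canonical representation $\kappa_L\colon[w]_L\mapsto(K\mapsto w^{-1}K)$ on $\mathrm{LQ}(L)$ (the semilattice of finite unions of left derivatives $u^{-1}L$), where extending means there is an injective join-preserving $f\colon\mathrm{LQ}(L)\to S$ with $f(w^{-1}K)=\rho([w]_L)(f(K))$. Equivalently (by the paper's main theorem), $\mathrm{nsyn}(L)$ is the least number of states of an nfa for $L$ all of whose states accept languages in the boolean algebra generated by the two-sided derivatives $u^{-1}Lv^{-1}$. *)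

theory Defs
  imports "HOL-Algebra.Elementary_Groups"
begin

definition lder :: "'a list \<Rightarrow> 'a list set \<Rightarrow> 'a list set" where
  "lder u K = {x. u @ x \<in> K}"

definition LQ :: "'a list set \<Rightarrow> 'a list set set" where
  "LQ L = {\<Union>U | U. finite U \<and> U \<subseteq> range (\<lambda>u. lder u L)}"

fun nfa_run :: "('q \<times> 'a \<times> 'q) set \<Rightarrow> 'q \<Rightarrow> 'a list \<Rightarrow> 'q set" where
  "nfa_run \<delta> p [] = {p}"
| "nfa_run \<delta> p (a # w) = (\<Union>q \<in> {q. (p, a, q) \<in> \<delta>}. nfa_run \<delta> q w)"

definition is_nfa :: "'q set \<Rightarrow> 'q set \<Rightarrow> 'q set \<Rightarrow> ('q \<times> 'a \<times> 'q) set \<Rightarrow> bool" where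
  "is_nfa Q I F \<delta> \<longleftrightarrow> finite Q \<and> I \<subseteq> Q \<and> F \<subseteq> Q \<and> \<delta> \<subseteq> Q \<times> UNIV \<times> Q"

definition nfa_lang :: "'q set \<Rightarrow> 'q set \<Rightarrow> ('q \<times> 'a \<times> 'q) set \<Rightarrow> 'a list set" where
  "nfa_lang I F \<delta> = {w. \<exists>p \<in> I. nfa_run \<delta> p w \<inter> F \<noteq> {}}"

definition regular :: "'a list set \<Rightarrow> bool" where
  "regular L \<longleftrightarrow> (\<exists>(Q :: nat set) I F \<delta>. is_nfa Q I F \<delta> \<and> nfa_lang I F \<delta> = L)"

(* ns(L): least number of states of an nfa accepting L
   (states taken from nat, which loses no generality) *)
definition ns :: "'a list set \<Rightarrow> nat" where
  "ns L = (LEAST n. \<exists>(Q :: nat set) I F \<delta>. is_nfa Q I F \<delta> \<and> nfa_lang I F \<delta> = L \<and> card Q = n)"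

definition syn_rel :: "'a list set \<Rightarrow> ('a list \<times> 'a list) set" where
  "syn_rel L = {(v, w). \<forall>x y. x @ v @ y \<in> L \<longleftrightarrow> x @ w @ y \<in> L}"

definition syn_class :: "'a list set \<Rightarrow> 'a list \<Rightarrow> 'a list set" where
  "syn_class L w = syn_rel L `` {w}"

definition syn_monoid :: "'a list set \<Rightarrow> 'a list set monoid" where
  "syn_monoid L =
     \<lparr> carrier = UNIV // syn_rel L,
       mult = (\<lambda>X Y. syn_rel L `` {x @ y | x y. x \<in> X \<and> y \<in> Y}),
       one = syn_class L [] \<rparr>"

definition fin_jsl :: "'s set \<Rightarrow> ('s \<Rightarrow> 's \<Rightarrow> 's) \<Rightarrow> 's \<Rightarrow> bool" where
  "fin_jsl S jn bt \<longleftrightarrow> finite S \<and> bt \<in> S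
     \<and> (\<forall>x\<in>S. \<forall>y\<in>S. jn x y \<in> S)
     \<and> (\<forall>x\<in>S. \<forall>y\<in>S. \<forall>z\<in>S. jn (jn x y) z = jn x (jn y z))
     \<and> (\<forall>x\<in>S. \<forall>y\<in>S. jn x y = jn y x)
     \<and> (\<forall>x\<in>S. jn x x = x)
     \<and> (\<forall>x\<in>S. jn bt x = x)"

definition join_irr :: "'s set \<Rightarrow> ('s \<Rightarrow> 's \<Rightarrow> 's) \<Rightarrow> 's \<Rightarrow> 's set" where
  "join_irr S jn bt =
     {j \<in> S. j \<noteq> bt \<and> (\<forall>a\<in>S. \<forall>b\<in>S. j = jn a b \<longrightarrow> j = a \<or> j = b)}"

definition jsl_endo :: "'s set \<Rightarrow> ('s \<Rightarrow> 's \<Rightarrow> 's) \<Rightarrow> 's \<Rightarrow> ('s \<Rightarrow> 's) \<Rightarrow> bool" where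
  "jsl_endo S jn bt g \<longleftrightarrow> (\<forall>x\<in>S. g x \<in> S) \<and> g bt = bt
     \<and> (\<forall>x\<in>S. \<forall>y\<in>S. g (jn x y) = jn (g x) (g y))"

(* rho : Syn(L) -> JSL(S,S) is a monoid morphism, where f \<cdot> g = g \<circ> f;
   maps are compared on the carrier S *)
definition bool_rep :: "'a list set \<Rightarrow> 's set \<Rightarrow> ('s \<Rightarrow> 's \<Rightarrow> 's) \<Rightarrow> 's
                        \<Rightarrow> ('a list set \<Rightarrow> 's \<Rightarrow> 's) \<Rightarrow> bool" where
  "bool_rep L S jn bt \<rho> \<longleftrightarrow>
     (\<forall>X \<in> carrier (syn_monoid L). jsl_endo S jn bt (\<rho> X))
     \<and> (\<forall>x\<in>S. \<rho> (\<one>\<^bsub>syn_monoid L\<^esub>) x = x)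
     \<and> (\<forall>X \<in> carrier (syn_monoid L). \<forall>Y \<in> carrier (syn_monoid L). \<forall>x\<in>S.
          \<rho> (X \<otimes>\<^bsub>syn_monoid L\<^esub> Y) x = \<rho> Y (\<rho> X x))"

definition extends_canonical :: "'a list set \<Rightarrow> 's set \<Rightarrow> ('s \<Rightarrow> 's \<Rightarrow> 's) \<Rightarrow> 's
                        \<Rightarrow> ('a list set \<Rightarrow> 's \<Rightarrow> 's) \<Rightarrow> bool" where
  "extends_canonical L S jn bt \<rho> \<longleftrightarrow>
     (\<exists>f :: 'a list set \<Rightarrow> 's.
        inj_on f (LQ L) \<and> f ` LQ L \<subseteq> S \<and> f {} = bt
        \<and> (\<forall>K\<in>LQ L. \<forall>K'\<in>LQ L. f (K \<union> K') = jn (f K) (f K'))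
        \<and> (\<forall>w. \<forall>K\<in>LQ L. f (lder w K) = \<rho> (syn_class L w) (f K)))"

(* nsyn(L): least degree |J(S)| of a boolean representation extending kappa_L
   (carriers taken in nat, which loses no generality for finite semilattices) *)
definition nsyn :: "'a list set \<Rightarrow> nat" where
  "nsyn L = (LEAST n. \<exists>(S :: nat set) jn bt \<rho>.
      fin_jsl S jn bt \<and> bool_rep L S jn bt \<rho>
      \<and> extends_canonical L S jn bt \<rho> \<and> card (join_irr S jn bt) = n)"

end

theory Submission
  imports Defs "HOL-Algebra.Multiplicative_Group"
begin

text \<open>
  A boolean representation on \<open>S\<close> yields an nfa on the join-irreducibles of \<open>S\<close>, so
  \<open>ns L \<le> nsyn L\<close> holds for every regular \<open>L\<close>. Conversely, let \<open>w\<close> represent a generator of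
  the syntactic group \<open>\<int>/n\<close>. In an nfa for \<open>L\<close>, replace the letters by the transition relation
  of \<open>w\<close>: this is a unary nfa accepting the \<open>n\<close>-periodic set \<open>{k. w\<^sup>k \<in> L}\<close>. Choose a cycle of
  length \<open>c \<le> |C|\<close> in each nontrivial strongly connected component \<open>C\<close>. Every sufficiently long
  accepting path can be pumped along one of these cycles, so \<open>L\<close> is a union of languages invariant
  under \<open>w\<^sup>c\<close>. Such a language has at most \<open>c\<close> derivatives, and the unions of all of them
  form a semilattice with at most as many join-irreducibles as the nfa has states.
\<close>

section \<open>The syntactic congruence\<close>

lemma lder_Nil [simp]: "lder [] K = K"
  by (simp add: lder_def)

lemma lder_append: "lder (u @ v) K = lder v (lder u K)"
  by (simp add: lder_def)

lemma lder_Union: "lder u (\<Union>U) = \<Union>(lder u ` U)"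
  by (auto simp: lder_def)

lemma equiv_syn_rel: "equiv UNIV (syn_rel L)"
  by (rule equivI) (auto simp: syn_rel_def refl_on_def sym_def trans_def)

lemma syn_rel_refl [simp]: "(x, x) \<in> syn_rel L"
  by (simp add: syn_rel_def)

lemma syn_rel_sym: "(x, y) \<in> syn_rel L \<Longrightarrow> (y, x) \<in> syn_rel L"
  by (simp add: syn_rel_def)

lemma syn_rel_trans [trans]: "(x, y) \<in> syn_rel L \<Longrightarrow> (y, z) \<in> syn_rel L \<Longrightarrow> (x, z) \<in> syn_rel L"
  by (simp add: syn_rel_def)

lemma syn_rel_append:
  assumes "(x, x') \<in> syn_rel L" "(y, y') \<in> syn_rel L"
  shows "(x @ y, x' @ y') \<in> syn_rel L"
  unfolding syn_rel_def
proof (clarify)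
  fix u v
  have "u @ (x @ y) @ v \<in> L \<longleftrightarrow> u @ x @ (y @ v) \<in> L" by simp
  also have "\<dots> \<longleftrightarrow> u @ x' @ (y @ v) \<in> L" using assms(1) unfolding syn_rel_def by blast
  also have "\<dots> \<longleftrightarrow> (u @ x') @ y @ v \<in> L" by simp
  also have "\<dots> \<longleftrightarrow> (u @ x') @ y' @ v \<in> L" using assms(2) unfolding syn_rel_def by blast
  finally show "u @ (x @ y) @ v \<in> L \<longleftrightarrow> u @ (x' @ y') @ v \<in> L" by simp
qed

lemma syn_rel_mem: "(x, y) \<in> syn_rel L \<Longrightarrow> x \<in> L \<longleftrightarrow> y \<in> L"
  unfolding syn_rel_def by (clarify, metis append_Nil append_Nil2)

lemma syn_class_eq_iff: "syn_class L x = syn_class L y \<longleftrightarrow> (x, y) \<in> syn_rel L"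
  unfolding syn_class_def by (simp add: eq_equiv_class_iff[OF equiv_syn_rel])

lemma carrier_syn_monoid: "carrier (syn_monoid L) = range (syn_class L)"
  by (auto simp: syn_monoid_def quotient_def syn_class_def)

lemma one_syn_monoid: "\<one>\<^bsub>syn_monoid L\<^esub> = syn_class L []"
  by (simp add: syn_monoid_def)

text \<open>The product in \<open>syn_monoid\<close> closes a product set under
  \<open>syn_rel\<close>. Since the relation is a congruence, all words of the product set lie in
  one class, so the closure is that class.\<close>

lemma mult_syn_class:
  "syn_class L x \<otimes>\<^bsub>syn_monoid L\<^esub> syn_class L y = syn_class L (x @ y)"
proof -
  have "(x @ y, z) \<in> syn_rel L"
    if "(x, x') \<in> syn_rel L" "(y, y') \<in> syn_rel L" "(x' @ y', z) \<in> syn_rel L" for x' y' z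
    using syn_rel_append that syn_rel_trans by blast
  then show ?thesis
    unfolding syn_monoid_def syn_class_def by auto (use syn_rel_refl in blast)
qed

section \<open>Powers of a word\<close>

definition word_pow :: "'a list \<Rightarrow> nat \<Rightarrow> 'a list" where
  "word_pow w k = concat (replicate k w)"

lemma word_pow_0 [simp]: "word_pow w 0 = []"
  by (simp add: word_pow_def)

lemma word_pow_1 [simp]: "word_pow w (Suc 0) = w"
  by (simp add: word_pow_def)

lemma word_pow_add: "word_pow w (i + j) = word_pow w i @ word_pow w j"
  by (simp add: word_pow_def replicate_add)

lemma nat_pow_syn_class:
  "syn_class L w [^]\<^bsub>syn_monoid L\<^esub> (k :: nat) = syn_class L (word_pow w k)"
proof (induction k)
  case (Suc k)
  then show ?case
    using mult_syn_class[of L "word_pow w k" w] word_pow_add[of w k 1] by simp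
qed (simp add: one_syn_monoid)

section \<open>From boolean representations to automata\<close>

lemma nfa_run_append: "nfa_run \<delta> p (u @ v) = (\<Union>q \<in> nfa_run \<delta> p u. nfa_run \<delta> q v)"
  by (induction u arbitrary: p) auto

lemma nfa_run_subset:
  assumes "is_nfa Q I F \<delta>" "p \<in> Q"
  shows "nfa_run \<delta> p w \<subseteq> Q"
  using assms(2)
proof (induction w arbitrary: p)
  case (Cons a w)
  have "q \<in> Q" if "(p, a, q) \<in> \<delta>" for q
    using that assms(1) by (auto simp: is_nfa_def)
  then show ?case using Cons.IH by auto
qed simp

text \<open>The order of the semilattice is expressed by \<open>jn x y = y\<close>.\<close>

lemma join_irr_detects:
  assumes S: "fin_jsl S jn bt"
    and g: "\<And>x. x \<in> S \<Longrightarrow> g x \<in> S" "g bt = bt"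
      "\<And>x y. x \<in> S \<Longrightarrow> y \<in> S \<Longrightarrow> g (jn x y) = jn (g x) (g y)"
    and x: "x \<in> S" and y: "y \<in> S" and nle: "jn (g x) y \<noteq> y"
  shows "\<exists>j \<in> join_irr S jn bt. jn j x = x \<and> jn (g j) y \<noteq> y"
proof -
  note J = S[unfolded fin_jsl_def]
  have fin: "finite S" using J by auto
  have as: "\<And>a b c. a \<in> S \<Longrightarrow> b \<in> S \<Longrightarrow> c \<in> S \<Longrightarrow> jn (jn a b) c = jn a (jn b c)"
    and com: "\<And>a b. a \<in> S \<Longrightarrow> b \<in> S \<Longrightarrow> jn a b = jn b a"
    and idem: "\<And>a. a \<in> S \<Longrightarrow> jn a a = a"
    and neu: "\<And>a. a \<in> S \<Longrightarrow> jn bt a = a"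
    using J by blast+
  \<comment> \<open>A minimal element of \<open>A\<close> is join-irreducible: if it were a join of
    two strictly smaller elements, both would lie outside \<open>A\<close>, so \<open>g\<close>
    would send both, and hence their join, below \<open>y\<close>. The size of the down-set
    \<open>d z\<close> serves as the measure to minimise.\<close>
  define A where "A = {z \<in> S. jn z x = x \<and> jn (g z) y \<noteq> y}"
  define d where "d z = {t \<in> S. jn t z = z}" for z
  have "x \<in> A" using x nle idem by (simp add: A_def)
  then obtain z where z: "z \<in> A" and min: "\<And>t. t \<in> A \<Longrightarrow> card (d z) \<le> card (d t)"
    using ex_has_least_nat[of "\<lambda>t. t \<in> A" x "\<lambda>t. card (d t)"] by blast
  have zS: "z \<in> S" and zx: "jn z x = x" and zy: "jn (g z) y \<noteq> y"
    using z by (auto simp: A_def)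
  have below: "jn (g t) y = y" if t: "t \<in> S" "jn t z = z" "t \<noteq> z" for t
  proof (rule ccontr)
    assume "jn (g t) y \<noteq> y"
    moreover have "jn t x = x" using as[OF t(1) zS x] t(2) zx by simp
    ultimately have "t \<in> A" using t(1) by (simp add: A_def)
    then have "card (d z) \<le> card (d t)" by (rule min)
    moreover have "d t \<subset> d z"
    proof
      show "d t \<subseteq> d z"
      proof
        fix s assume "s \<in> d t"
        then show "s \<in> d z" using as[of s t z] t zS by (auto simp: d_def)
      qed
      have "z \<notin> d t" using com[OF t(1) zS] t by (auto simp: d_def)
      then show "d t \<noteq> d z" using idem[OF zS] zS by (auto simp: d_def)
    qed
    then have "card (d t) < card (d z)"
      using fin by (intro psubset_card_mono) (auto simp: d_def)
    ultimately show False by simp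
  qed
  have "z \<in> join_irr S jn bt"
    unfolding join_irr_def
  proof (intro CollectI conjI ballI impI)
    show "z \<in> S" by fact
    \<comment> \<open>The bottom element is not in \<open>A\<close>, because \<open>g\<close> fixes
      it and it lies below \<open>y\<close>.\<close>
    show "z \<noteq> bt" using zy g(2) neu y by auto
    fix a b assume ab: "a \<in> S" "b \<in> S" "z = jn a b"
    show "z = a \<or> z = b"
    proof (rule ccontr)
      assume *: "\<not> (z = a \<or> z = b)"
      have "jn a z = z" using as[of a a b] ab idem by simp
      then have ga: "jn (g a) y = y" using * ab by (intro below) auto
      have "jn b z = z" using as[of b b a] ab idem com[of a b] by simp
      then have gb: "jn (g b) y = y" using * ab by (intro below) auto
      have "jn (g z) y = jn (g a) (jn (g b) y)" using ab g as y by simp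
      with ga gb zy show False by simp
    qed
  qed
  with zx zy show ?thesis by blast
qed

text \<open>Initial states are the join-irreducibles below \<open>f L\<close>, and the letter
  \<open>a\<close> leads from \<open>j\<close> to those below the image of \<open>j\<close> under
  the class of \<open>a\<close>. A state is final if it is not below \<open>y = f K0\<close>. So
  \<open>w\<close> is rejected iff the image of \<open>f L\<close> under \<open>w\<close> is below
  \<open>y\<close>, that is, iff the derivative of \<open>L\<close> by \<open>w\<close> is contained
  in \<open>K0\<close>.\<close>

lemma nfa_of_bool_rep:
  fixes L :: "'a list set" and S :: "'s set"
  assumes S: "fin_jsl S jn bt" and rep: "bool_rep L S jn bt \<rho>"
    and ext: "extends_canonical L S jn bt \<rho>"
  shows "\<exists>I F \<delta>. is_nfa (join_irr S jn bt) I F \<delta> \<and> nfa_lang I F \<delta> = L"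
proof -
  let ?J = "join_irr S jn bt"
  let ?r = "\<lambda>w. \<rho> (syn_class L w)"
  note J = S[unfolded fin_jsl_def]
  have fin: "finite S" using J by auto
  have as: "\<And>a b c. a \<in> S \<Longrightarrow> b \<in> S \<Longrightarrow> c \<in> S \<Longrightarrow> jn (jn a b) c = jn a (jn b c)"
    using J by blast+
  have rS: "?r w x \<in> S" if "x \<in> S" for w x
    using rep that unfolding bool_rep_def jsl_endo_def carrier_syn_monoid by blast
  have rbt: "?r w bt = bt" for w
    using rep unfolding bool_rep_def jsl_endo_def carrier_syn_monoid by blast
  have rjn: "?r w (jn x y) = jn (?r w x) (?r w y)" if "x \<in> S" "y \<in> S" for w x y
    using rep that unfolding bool_rep_def jsl_endo_def carrier_syn_monoid by blast
  have r1: "?r [] x = x" if "x \<in> S" for x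
    using rep that by (simp add: bool_rep_def one_syn_monoid)
  have rmult: "?r (u @ v) x = ?r v (?r u x)" if "x \<in> S" for u v x
    using rep that unfolding bool_rep_def carrier_syn_monoid
    by (metis mult_syn_class rangeI)
  obtain f where inj: "inj_on f (LQ L)" and fS: "f ` LQ L \<subseteq> S"
    and fjn: "\<And>K K'. K \<in> LQ L \<Longrightarrow> K' \<in> LQ L \<Longrightarrow> f (K \<union> K') = jn (f K) (f K')"
    and fr: "\<And>w K. K \<in> LQ L \<Longrightarrow> f (lder w K) = ?r w (f K)"
    using ext unfolding extends_canonical_def by blast
  have JS: "?J \<subseteq> S" by (auto simp: join_irr_def)
  have deriv: "lder u L \<in> LQ L" for u
    unfolding LQ_def by (rule CollectI, rule exI[of _ "{lder u L}"]) auto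
  have fin_LQ: "finite (LQ L)" using inj fS fin by (meson finite_imageD finite_subset)
  \<comment> \<open>The union \<open>K0\<close> of the derivatives without the empty word turns the
    test for the empty word into an inclusion. It is a finite union, hence in \<open>LQ L\<close>,
    because \<open>f\<close> embeds \<open>LQ L\<close> into the finite set
    \<open>S\<close>.\<close>
  define N where "N = {K \<in> range (\<lambda>u. lder u L). [] \<notin> K}"
  define K0 where "K0 = \<Union>N"
  have "N \<subseteq> LQ L" using deriv by (auto simp: N_def)
  then have "finite N" using fin_LQ finite_subset by blast
  then have K0: "K0 \<in> LQ L" unfolding K0_def LQ_def N_def by blast
  have K0_iff: "K \<subseteq> K0 \<longleftrightarrow> [] \<notin> K" if "K \<in> range (\<lambda>u. lder u L)" for K
    using that by (auto simp: K0_def N_def)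
  define y where "y = f K0"
  have yS: "y \<in> S" using fS K0 by (auto simp: y_def)
  define I where "I = {j \<in> ?J. jn j (f L) = f L}"
  define F where "F = {j \<in> ?J. jn j y \<noteq> y}"
  define \<delta> where "\<delta> = {(j, a, j'). j \<in> ?J \<and> j' \<in> ?J \<and> jn j' (?r [a] j) = ?r [a] j}"
  have nfa: "is_nfa ?J I F \<delta>"
    using fin JS by (auto simp: is_nfa_def I_def F_def \<delta>_def intro: finite_subset)
  \<comment> \<open>To test whether the image of \<open>x\<close> is below \<open>y\<close>, it
    suffices to test the join-irreducibles below \<open>x\<close>. This is what allows an element of
    \<open>S\<close> to be replaced by a set of states.\<close>
  have below: "jn (?r w x) y = y \<longleftrightarrow> (\<forall>j \<in> ?J. jn j x = x \<longrightarrow> jn (?r w j) y = y)"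
    if x: "x \<in> S" for w x
  proof
    assume le: "jn (?r w x) y = y"
    show "\<forall>j \<in> ?J. jn j x = x \<longrightarrow> jn (?r w j) y = y"
    proof (intro ballI impI)
      fix j assume "j \<in> ?J" and jx: "jn j x = x"
      then have jS: "j \<in> S" using JS by blast
      have "jn (?r w j) y = jn (?r w j) (jn (?r w x) y)" using le by simp
      also have "\<dots> = jn (jn (?r w j) (?r w x)) y"
        using jS x yS by (intro as[symmetric] rS)
      also have "\<dots> = y" using rjn[OF jS x, of w] jx le by simp
      finally show "jn (?r w j) y = y" .
    qed
  next
    assume le: "\<forall>j \<in> ?J. jn j x = x \<longrightarrow> jn (?r w j) y = y"
    show "jn (?r w x) y = y"
    proof (rule ccontr)
      assume "jn (?r w x) y \<noteq> y"
      then have "\<exists>j \<in> ?J. jn j x = x \<and> jn (?r w j) y \<noteq> y"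
        by (intro join_irr_detects[where g = "?r w", OF S]) (simp_all add: rS rbt rjn x yS)
      with le show False by blast
    qed
  qed
  \<comment> \<open>The claim is stated for rejection: \<open>below\<close> then merges the
    condition on all successors of \<open>j\<close> into a single condition on the image of
    \<open>j\<close>.\<close>
  have run: "(\<forall>j' \<in> nfa_run \<delta> j w. jn j' y = y) \<longleftrightarrow> jn (?r w j) y = y" if "j \<in> ?J" for j w
    using that
  proof (induction w arbitrary: j)
    case Nil
    then show ?case using r1 JS by auto
  next
    case (Cons a w)
    then have jS: "j \<in> S" using JS by blast
    have "(\<forall>j' \<in> nfa_run \<delta> j (a # w). jn j' y = y) \<longleftrightarrow>
        (\<forall>q \<in> ?J. jn q (?r [a] j) = ?r [a] j \<longrightarrow> (\<forall>j' \<in> nfa_run \<delta> q w. jn j' y = y))"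
      using Cons.prems by (auto simp: \<delta>_def)
    also have "\<dots> \<longleftrightarrow> jn (?r w (?r [a] j)) y = y"
      using below[of "?r [a] j" w] rS[OF jS] Cons.IH by simp
    finally show ?case using rmult[OF jS, of "[a]" w] by simp
  qed
  have L: "L \<in> LQ L" using deriv[of "[]"] by simp
  have "w \<in> nfa_lang I F \<delta> \<longleftrightarrow> w \<in> L" for w
  proof -
    have "w \<notin> nfa_lang I F \<delta> \<longleftrightarrow> (\<forall>p \<in> I. \<forall>j' \<in> nfa_run \<delta> p w. jn j' y = y)"
      using nfa_run_subset[OF nfa] by (fastforce simp: nfa_lang_def F_def I_def)
    also have "\<dots> \<longleftrightarrow> jn (?r w (f L)) y = y"
      using below[of "f L" w] fS L run by (auto simp: I_def)
    also have "\<dots> \<longleftrightarrow> f (lder w L \<union> K0) = f K0"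
      using fr[OF L] fjn[OF deriv K0] by (simp add: y_def)
    also have "\<dots> \<longleftrightarrow> lder w L \<union> K0 = K0"
    proof -
      \<comment> \<open>Injectivity of \<open>f\<close> is available only on \<open>LQ L\<close>, so
        the union has to be a member of it.\<close>
      have "K0 \<union> lder w L \<in> LQ L"
        unfolding K0_def LQ_def using \<open>finite N\<close>
        by (intro CollectI exI[of _ "insert (lder w L) N"]) (auto simp: N_def)
      then show ?thesis using inj K0 by (auto simp: inj_on_def Un_commute)
    qed
    also have "\<dots> \<longleftrightarrow> w \<notin> L" using K0_iff[of "lder w L"] by (auto simp: lder_def)
    finally show ?thesis by blast
  qed
  then show ?thesis using nfa by blast
qed

section \<open>From families of languages to boolean representations\<close>

text \<open>The semilattice consists of all unions of members of \<open>B\<close>, on which words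
  act by left derivatives. Saturation makes the action depend on the syntactic class only. The
  members of \<open>B\<close> generate the semilattice under joins, so every join-irreducible is one
  of them.\<close>

lemma bool_rep_of_derivative_family:
  fixes L :: "'a list set"
  assumes fin: "finite B"
    and sat: "\<And>K x y. K \<in> B \<Longrightarrow> (x, y) \<in> syn_rel L \<Longrightarrow> x \<in> K \<Longrightarrow> y \<in> K"
    and der: "\<And>K u. K \<in> B \<Longrightarrow> lder u K \<in> B"
    and L: "\<exists>U \<subseteq> B. L = \<Union>U"
  shows "\<exists>(S :: nat set) jn bt \<rho>. fin_jsl S jn bt \<and> bool_rep L S jn bt \<rho>
      \<and> extends_canonical L S jn bt \<rho> \<and> card (join_irr S jn bt) \<le> card B"
proof -
  define T where "T = {\<Union>U | U. U \<subseteq> B}"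
  have TI: "\<Union>U \<in> T" if "U \<subseteq> B" for U
    using that unfolding T_def by blast
  have TE: "\<exists>U \<subseteq> B. K = \<Union>U" if "K \<in> T" for K
    using that unfolding T_def by blast
  have "T = Union ` Pow B" by (auto simp: T_def)
  then have "finite T" using fin by simp
  \<comment> \<open>\<open>nsyn\<close> ranges over carriers in \<open>nat\<close>, so
    \<open>T\<close> is transported along an encoding \<open>e\<close> with decoding
    \<open>d\<close>.\<close>
  then obtain e :: "'a list set \<Rightarrow> nat" where e: "inj_on e T"
    using finite_imp_inj_to_nat_seg by blast
  define d where "d = inv_into T e"
  have d: "d (e K) = K" if "K \<in> T" for K using e that by (simp add: d_def)
  have T_UNION: "\<Union>A \<in> T" if "A \<subseteq> T" for A
  proof -
    have "\<Union>A = \<Union>{K \<in> B. K \<subseteq> \<Union>A}"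
    proof
      show "\<Union>A \<subseteq> \<Union>{K \<in> B. K \<subseteq> \<Union>A}"
      proof
        fix x assume "x \<in> \<Union>A"
        then obtain K where K: "K \<in> A" "x \<in> K" by blast
        then obtain U where U: "U \<subseteq> B" "K = \<Union>U" using TE \<open>A \<subseteq> T\<close> by blast
        with K show "x \<in> \<Union>{K \<in> B. K \<subseteq> \<Union>A}" by blast
      qed
    qed auto
    then show ?thesis using TI[of "{K \<in> B. K \<subseteq> \<Union>A}"] by simp
  qed
  have T_Un: "K \<union> K' \<in> T" if "K \<in> T" "K' \<in> T" for K K'
    using T_UNION[of "{K, K'}"] that by simp
  have T_empty: "{} \<in> T" using T_UNION[of "{}"] by simp
  have T_der: "lder u K \<in> T" if K: "K \<in> T" for u K
  proof -
    obtain U where "U \<subseteq> B" "K = \<Union>U" using TE[OF K] by blast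
    then show ?thesis using der by (auto simp: lder_Union intro!: TI)
  qed
  have T_sat: "y \<in> K" if "K \<in> T" "(x, y) \<in> syn_rel L" "x \<in> K" for K x y
    using that sat TE[of K] by blast
  have der_cong: "lder u K = lder v K" if "K \<in> T" "(u, v) \<in> syn_rel L" for u v K
    unfolding lder_def
    using that syn_rel_append[OF that(2) syn_rel_refl] T_sat syn_rel_sym by blast
  have LQ_T: "LQ L \<subseteq> T"
  proof
    fix K assume "K \<in> LQ L"
    then obtain U where U: "U \<subseteq> range (\<lambda>u. lder u L)" "K = \<Union>U" unfolding LQ_def by blast
    have "L \<in> T" using L TI by blast
    then have "U \<subseteq> T" using U(1) T_der by auto
    then show "K \<in> T" using U(2) T_UNION by simp
  qed
  define S where "S = e ` T"
  define jn where "jn x y = e (d x \<union> d y)" for x y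
  define bt where "bt = e {}"
  \<comment> \<open>A class acts through an arbitrary representative; \<open>der_cong\<close> makes
    the choice immaterial.\<close>
  define \<rho> where "\<rho> X x = e (lder (SOME v. v \<in> X) (d x))" for X x
  have rho: "\<rho> (syn_class L v) (e K) = e (lder v K)" if K: "K \<in> T" for v K
  proof -
    have "(SOME u. u \<in> syn_class L v) \<in> syn_class L v"
      by (rule someI[of _ v]) (simp add: syn_class_def)
    then have "(v, SOME u. u \<in> syn_class L v) \<in> syn_rel L" by (simp add: syn_class_def)
    then show ?thesis using der_cong[OF K] d[OF K] by (simp add: \<rho>_def)
  qed
  have jn_e: "jn (e K) (e K') = e (K \<union> K')" if "K \<in> T" "K' \<in> T" for K K'
    using that by (simp add: jn_def d)
  have "fin_jsl S jn bt"
    using \<open>finite T\<close> T_empty T_Un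
    by (auto simp: fin_jsl_def S_def bt_def jn_e Un_ac)
  moreover have "bool_rep L S jn bt \<rho>"
  proof -
    have "lder v {} = {}" "lder v (K \<union> K') = lder v K \<union> lder v K'" for v and K K' :: "'a list set"
      by (auto simp: lder_def)
    then show ?thesis
      unfolding bool_rep_def carrier_syn_monoid one_syn_monoid jsl_endo_def S_def bt_def
      by (simp add: rho mult_syn_class lder_append jn_e T_der T_empty T_Un)
  qed
  moreover have "extends_canonical L S jn bt \<rho>"
    unfolding extends_canonical_def
  proof (intro exI[of _ e] conjI ballI allI)
    show "inj_on e (LQ L)" using e LQ_T inj_on_subset by blast
    show "e ` LQ L \<subseteq> S" using LQ_T by (auto simp: S_def)
    show "e {} = bt" by (simp add: bt_def)
    show "e (K \<union> K') = jn (e K) (e K')" if "K \<in> LQ L" "K' \<in> LQ L" for K K'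
      using jn_e[OF subsetD[OF LQ_T] subsetD[OF LQ_T]] that by simp
    show "e (lder w K) = \<rho> (syn_class L w) (e K)" if "K \<in> LQ L" for w K
      using that LQ_T rho by auto
  qed
  moreover have "join_irr S jn bt \<subseteq> e ` B"
  proof
    fix x assume x: "x \<in> join_irr S jn bt"
    then obtain K where K: "K \<in> T" "x = e K" by (auto simp: join_irr_def S_def)
    obtain U where U: "U \<subseteq> B" "K = \<Union>U" using TE[OF K(1)] by blast
    have "finite U" using U(1) fin finite_subset by blast
    \<comment> \<open>Members are split off the finite union one at a time; at each split,
      irreducibility forces \<open>K\<close> to be the removed member or the remaining
      union.\<close>
    then have "K \<in> U" using U
    proof (induction U)
      case empty
      then show ?case using x K by (simp add: join_irr_def bt_def)
    next
      case (insert C V)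
      have C: "C \<in> T" and V: "\<Union>V \<in> T" using insert.prems TI[of "{C}"] TI[of V] by auto
      have "x = jn (e C) (e (\<Union>V))" using K insert.prems jn_e[OF C V] by simp
      then have "x = e C \<or> x = e (\<Union>V)" using x C V by (auto simp: join_irr_def S_def)
      then have "K = C \<or> K = \<Union>V" using e C V K by (auto simp: inj_on_def)
      then show ?case using insert by auto
    qed
    then show "x \<in> e ` B" using U K by blast
  qed
  then have "card (join_irr S jn bt) \<le> card B"
    using fin by (meson card_image_le card_mono finite_imageI le_trans)
  ultimately show ?thesis by blast
qed

section \<open>Unary automata with periodic behaviour\<close>

lemma relpow_compose: "(x, y) \<in> R ^^ i \<Longrightarrow> (y, z) \<in> R ^^ j \<Longrightarrow> (x, z) \<in> R ^^ (i + j)"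
  by (auto simp: relpow_add)

lemma relpow_cycle: "(x, x) \<in> R ^^ c \<Longrightarrow> (x, x) \<in> R ^^ (k * c)"
  by (induction k) (auto intro: relpow_compose)

text \<open>A path of at least \<open>card Q\<close> steps visits more positions than there are
  vertices, so some vertex repeats.\<close>

lemma long_path_meets_cycle:
  assumes "finite Q" "R \<subseteq> Q \<times> Q" "p \<in> Q" "(p, q) \<in> R ^^ k" "card Q \<le> k"
  obtains v i j where "(p, v) \<in> R ^^ i" "(v, v) \<in> R\<^sup>+" "(v, q) \<in> R ^^ j" "k = i + j"
proof -
  obtain f where f: "f 0 = p" "f k = q" and step: "\<And>i. i < k \<Longrightarrow> (f i, f (Suc i)) \<in> R"
    using assms(4) by (auto simp: relpow_fun_conv)
  have seg: "(f i, f (i + d)) \<in> R ^^ d" if "i + d \<le> k" for i d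
    using that step by (induction d) auto
  have "f i \<in> Q" if "i \<le> k" for i
    using that f step[of "i - 1"] assms(2,3) by (cases i) auto
  then have "f ` {..k} \<subseteq> Q" by auto
  then have "card (f ` {..k}) \<le> card Q" using assms(1) card_mono by blast
  then have "\<not> inj_on f {..k}" using assms(5) card_image by fastforce
  then obtain i j where ij: "i < j" "j \<le> k" "f i = f j"
    unfolding inj_on_def by (metis atMost_iff nat_neq_iff)
  show thesis
  proof
    show "(p, f i) \<in> R ^^ i" using seg[of 0 i] ij f by simp
    have "(f i, f i) \<in> R ^^ (j - i)" using seg[of i "j - i"] ij by simp
    then show "(f i, f i) \<in> R\<^sup>+"
      using ij unfolding trancl_power by (intro exI[of _ "j - i"]) simp
    show "(f i, q) \<in> R ^^ (k - i)" using seg[of i "k - i"] ij f by simp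
    show "k = i + (k - i)" using ij by simp
  qed
qed

text \<open>Iterating a successor function inside \<open>C\<close> repeats a vertex within
  \<open>card C\<close> steps. The cycle found need not pass through \<open>v\<close>.\<close>

lemma short_cycle:
  assumes fin: "finite C" and v: "v \<in> C" and succ: "\<And>x. x \<in> C \<Longrightarrow> \<exists>y \<in> C. (x, y) \<in> R"
  shows "\<exists>c u. 0 < c \<and> c \<le> card C \<and> u \<in> C \<and> (u, u) \<in> R ^^ c"
proof -
  obtain s where s: "\<And>x. x \<in> C \<Longrightarrow> s x \<in> C \<and> (x, s x) \<in> R"
    using succ by metis
  define g where "g i = (s ^^ i) v" for i
  have g: "g i \<in> C" for i by (induction i) (auto simp: g_def v s)
  have seg: "(g i, g (i + d)) \<in> R ^^ d" for i d
  proof (induction d)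
    case (Suc d)
    have "(g (i + d), g (i + Suc d)) \<in> R" using s[OF g[of "i + d"]] by (simp add: g_def)
    then show ?case using Suc by auto
  qed simp
  have "card (g ` {..card C}) \<le> card C" using g fin by (intro card_mono) auto
  then have "\<not> inj_on g {..card C}" using card_image by fastforce
  then obtain i j where "i < j" "j \<le> card C" "g i = g j"
    unfolding inj_on_def by (metis atMost_iff nat_neq_iff)
  then show ?thesis using seg[of i "j - i"] g by (intro exI[of _ "j - i"] exI[of _ "g i"]) auto
qed

lemma periodic_unary_nfa_cycles:
  assumes fin: "finite Q" and R: "R \<subseteq> Q \<times> Q" and I: "I \<subseteq> Q" and n: "0 < (n :: nat)"
    and per: "\<And>k. P (k + n) \<longleftrightarrow> P k"
    and P: "\<And>k. P k \<longleftrightarrow> (\<exists>p \<in> I. \<exists>q \<in> F. (p, q) \<in> R ^^ k)"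
  shows "\<exists>D. finite D \<and> 0 \<notin> D \<and> \<Sum>D \<le> card Q \<and> (\<forall>a. P a \<longrightarrow> (\<exists>c \<in> D. \<forall>k. P (a + k * c)))"
proof -
  define C where "C v = {u. (v, u) \<in> R\<^sup>+ \<and> (u, v) \<in> R\<^sup>+}" for v
  define V where "V = {v. (v, v) \<in> R\<^sup>+}"
  have RQ: "R\<^sup>+ \<subseteq> Q \<times> Q" using R by (rule trancl_subset_Sigma)
  have CQ: "C v \<subseteq> Q" for v using RQ by (auto simp: C_def)
  have finC: "finite (C v)" for v using CQ fin finite_subset by blast
  have "V \<subseteq> Q" using RQ by (auto simp: V_def)
  then have finV: "finite V" using fin finite_subset by blast
  have disj: "pairwise disjnt (C ` V)"
  proof (rule pairwiseI)
    fix X Y assume "X \<in> C ` V" "Y \<in> C ` V" "X \<noteq> Y"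
    moreover have "C u = C v" if "x \<in> C u" "x \<in> C v" for x u v
      using that unfolding C_def by (blast intro: trancl_trans)
    ultimately show "disjnt X Y" unfolding disjnt_def by blast
  qed
  have "\<exists>c. 0 < c \<and> c \<le> card X \<and> (\<exists>u \<in> X. (u, u) \<in> R ^^ c)" if X: "X \<in> C ` V" for X
  proof -
    obtain v where v: "X = C v" "(v, v) \<in> R\<^sup>+" using X by (auto simp: V_def)
    have "\<exists>y \<in> C v. (x, y) \<in> R" if "x \<in> C v" for x
    proof -
      have x: "(v, x) \<in> R\<^sup>+" "(x, v) \<in> R\<^sup>+" using that by (auto simp: C_def)
      then obtain y where "(x, y) \<in> R" "(y, x) \<in> R\<^sup>*" by (meson trancl_trans tranclD)
      then show ?thesis
        using x unfolding C_def by (blast intro: trancl_into_trancl rtrancl_trancl_trancl)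
    qed
    moreover have "v \<in> C v" using v by (simp add: C_def)
    ultimately show ?thesis using short_cycle[OF finC] v by blast
  qed
  then obtain c where c: "\<And>X. X \<in> C ` V \<Longrightarrow> 0 < c X \<and> c X \<le> card X \<and> (\<exists>u \<in> X. (u, u) \<in> R ^^ c X)"
    by metis
  \<comment> \<open>Only an inequality: components with equal cycle lengths contribute a single
    element to the set of lengths.\<close>
  have "\<Sum>(c ` C ` V) \<le> (\<Sum>X \<in> C ` V. c X)"
    using sum_image_le[of "C ` V" "\<lambda>x. x" c] finV by (simp add: o_def)
  also have "\<dots> \<le> (\<Sum>X \<in> C ` V. card X)" using c by (intro sum_mono) blast
  also have "\<dots> = card (\<Union>(C ` V))" using disj finC by (intro card_Union_disjoint[symmetric]) auto
  also have "\<dots> \<le> card Q" using CQ fin by (intro card_mono) auto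
  finally have sum: "\<Sum>(c ` C ` V) \<le> card Q" .
  have per_mult: "P (k + m * n) \<longleftrightarrow> P k" for k m
  proof (induction m)
    case (Suc m)
    then show ?case using per[of "k + m * n"] by (simp add: ac_simps)
  qed simp
  have "\<exists>d \<in> c ` C ` V. \<forall>k. P (a + k * d)" if "P a" for a
  proof -
    \<comment> \<open>Padding by a multiple of the period preserves \<open>P\<close> and makes the
      accepting path long enough to meet a cycle.\<close>
    have "P (a + card Q * n)" using that per_mult by simp
    then obtain p q where pq: "p \<in> I" "q \<in> F" "(p, q) \<in> R ^^ (a + card Q * n)" using P by blast
    have "card Q \<le> a + card Q * n" using n by (simp add: trans_le_add2)
    then obtain v i j where v: "(p, v) \<in> R ^^ i" "(v, v) \<in> R\<^sup>+" "(v, q) \<in> R ^^ j"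
      and len: "a + card Q * n = i + j"
      using long_path_meets_cycle[OF fin R _ pq(3)] pq(1) I by blast
    have X: "C v \<in> C ` V" using v by (simp add: V_def)
    then obtain u where u: "u \<in> C v" "(u, u) \<in> R ^^ c (C v)" using c by blast
    then obtain s t where st: "(v, u) \<in> R ^^ s" "(u, v) \<in> R ^^ t"
      by (auto simp: C_def trancl_power)
    have "P (a + k * c (C v))" for k
    proof -
      \<comment> \<open>Going from \<open>v\<close> to \<open>u\<close> and back \<open>n\<close> times costs a multiple of the period.\<close>
      have "(v, v) \<in> R ^^ ((n - 1) * (s + t))"
        by (rule relpow_cycle[OF relpow_compose[OF st]])
      moreover have "(v, v) \<in> R ^^ (s + k * c (C v) + t)"
        by (rule relpow_compose[OF relpow_compose[OF st(1) relpow_cycle[OF u(2)]] st(2)])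
      ultimately have vv: "(v, v) \<in> R ^^ ((n - 1) * (s + t) + (s + k * c (C v) + t))"
        by (rule relpow_compose)
      have "(p, q) \<in> R ^^ (i + ((n - 1) * (s + t) + (s + k * c (C v) + t)) + j)"
        by (rule relpow_compose[OF relpow_compose[OF v(1) vv] v(3)])
      then have "P (i + ((n - 1) * (s + t) + (s + k * c (C v) + t)) + j)" using P pq by blast
      moreover have "(n - 1) * (s + t) + (s + t) = (s + t) * n"
        using n by (cases n) (auto simp: algebra_simps)
      then have "i + ((n - 1) * (s + t) + (s + k * c (C v) + t)) + j
          = (a + k * c (C v)) + (card Q + (s + t)) * n"
        using len unfolding distrib_right[of "card Q"] by linarith
      ultimately show ?thesis using per_mult by metis
    qed
    with X show ?thesis by blast
  qed
  moreover have "0 \<notin> c ` C ` V" using c by fastforce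
  moreover have "finite (c ` C ` V)" using finV by simp
  ultimately show ?thesis using sum by (intro exI[of _ "c ` C ` V"]) blast
qed

section \<open>Languages with cyclic syntactic group\<close>

text \<open>Words inducing the same transition relation \<open>\<phi>\<close> on \<open>Q\<close>
  are syntactically equivalent, and there are finitely many relations on \<open>Q\<close>.\<close>

lemma finite_syn_monoid:
  assumes "regular L"
  shows "finite (carrier (syn_monoid L))"
proof -
  obtain Q :: "nat set" and I F \<delta> where nfa: "is_nfa Q I F \<delta>" and L: "nfa_lang I F \<delta> = L"
    using assms by (auto simp: regular_def)
  define \<phi> where "\<phi> x = {(p, q). p \<in> Q \<and> q \<in> nfa_run \<delta> p x}" for x
  have I: "I \<subseteq> Q" and finQ: "finite Q" using nfa by (auto simp: is_nfa_def)
  have run: "nfa_run \<delta> p (u @ x @ v) = (\<Union>q \<in> nfa_run \<delta> p u. \<Union>q' \<in> \<phi> x `` {q}. nfa_run \<delta> q' v)"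
    if "p \<in> I" for p u x v
  proof -
    have "\<phi> x `` {q} = nfa_run \<delta> q x" if "q \<in> nfa_run \<delta> p u" for q
      using that nfa_run_subset[OF nfa, of p u] \<open>p \<in> I\<close> I by (auto simp: \<phi>_def)
    then show ?thesis by (simp add: nfa_run_append)
  qed
  have eq: "syn_class L x = syn_class L y" if "\<phi> x = \<phi> y" for x y
    unfolding syn_class_eq_iff syn_rel_def L[symmetric] nfa_lang_def
    using that by (simp add: run cong: bex_cong)
  have "range \<phi> \<subseteq> Pow (Q \<times> Q)" using nfa_run_subset[OF nfa] by (auto simp: \<phi>_def)
  then have "finite (range \<phi>)" using finQ finite_subset by blast
  moreover have "range (syn_class L) \<subseteq> (\<lambda>X. syn_class L (inv_into UNIV \<phi> X)) ` range \<phi>"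
  proof clarify
    fix x
    have "syn_class L x = syn_class L (inv_into UNIV \<phi> (\<phi> x))" by (rule eq) (simp add: f_inv_into_f)
    then show "syn_class L x \<in> (\<lambda>X. syn_class L (inv_into UNIV \<phi> X)) ` range \<phi>" by blast
  qed
  ultimately show ?thesis unfolding carrier_syn_monoid using finite_surj by blast
qed

text \<open>\<open>w\<close> represents a generator and \<open>n\<close> is its order. Finiteness
  makes the order positive, so natural exponents already reach every class and no inverse of
  \<open>w\<close> is required.\<close>

lemma cyclic_syn_monoid_generator:
  assumes "finite (carrier (syn_monoid L))" "group (syn_monoid L)" "cyclic_group (syn_monoid L)"
  obtains w n where "0 < n" "(word_pow w n, []) \<in> syn_rel L"
    "\<And>x. \<exists>k. (x, word_pow w k) \<in> syn_rel L"
proof -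
  interpret group "syn_monoid L" by fact
  obtain g where g: "g \<in> carrier (syn_monoid L)"
    and gen: "carrier (syn_monoid L) = range (\<lambda>z :: int. g [^]\<^bsub>syn_monoid L\<^esub> z)"
    using assms(3) cyclic_group by blast
  obtain w where w: "g = syn_class L w" using g by (auto simp: carrier_syn_monoid)
  have ord: "0 < ord g" using ord_ge_1[OF assms(1) g] by simp
  show thesis
  proof
    show "0 < ord g" by fact
    show "(word_pow w (ord g), []) \<in> syn_rel L"
      using pow_ord_eq_1[OF g] by (simp add: w nat_pow_syn_class one_syn_monoid syn_class_eq_iff)
    fix x
    have "carrier (syn_monoid L) = generate (syn_monoid L) {g}"
      unfolding gen generate_pow[OF g] by (simp add: full_SetCompr_eq)
    then have "syn_class L x \<in> generate (syn_monoid L) {g}"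
      by (metis carrier_syn_monoid rangeI)
    then obtain k :: nat where "syn_class L x = g [^]\<^bsub>syn_monoid L\<^esub> k"
      unfolding generate_pow_nat[OF g ord[THEN gr_implies_not0]] by (elim CollectE exE conjE)
    then show "\<exists>k. (x, word_pow w k) \<in> syn_rel L"
      by (auto simp: w nat_pow_syn_class syn_class_eq_iff)
  qed
qed

text \<open>\<open>B\<close> collects the derivatives of the languages \<open>M c\<close> for the
  cycle lengths \<open>c\<close> in \<open>D\<close>. Every word acts on \<open>M c\<close> like a
  power of \<open>w\<close>, and exponents count only modulo \<open>c\<close>, so \<open>M c\<close>
  contributes at most \<open>c\<close> languages and \<open>B\<close> at most the sum of
  \<open>D\<close>.\<close>

lemma derivative_family_of_nfa:
  fixes L :: "'a list set"
  assumes n: "0 < n" and period: "(word_pow w n, []) \<in> syn_rel L"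
    and gen: "\<And>x. \<exists>k. (x, word_pow w k) \<in> syn_rel L"
    and nfa: "is_nfa Q I F \<delta>" and L: "nfa_lang I F \<delta> = L"
  obtains B where "finite B" "card B \<le> card Q"
    "\<And>K x y. K \<in> B \<Longrightarrow> (x, y) \<in> syn_rel L \<Longrightarrow> x \<in> K \<Longrightarrow> y \<in> K"
    "\<And>K u. K \<in> B \<Longrightarrow> lder u K \<in> B"
    "\<exists>U \<subseteq> B. L = \<Union>U"
proof -
  let ?w = "word_pow w"
  have fin: "finite Q" and I: "I \<subseteq> Q" using nfa by (auto simp: is_nfa_def)
  define R where "R = {(p, q). p \<in> Q \<and> q \<in> nfa_run \<delta> p w}"
  have R: "R \<subseteq> Q \<times> Q" using nfa_run_subset[OF nfa] by (auto simp: R_def)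
  have R_pow: "(p, q) \<in> R ^^ k \<longleftrightarrow> q \<in> nfa_run \<delta> p (?w k)" if p: "p \<in> Q" for p q k
  proof (induction k arbitrary: q)
    case (Suc k)
    have "?w (Suc k) = ?w k @ w" using word_pow_add[of w k 1] by simp
    then show ?case
      using Suc nfa_run_subset[OF nfa p] by (auto simp: nfa_run_append R_def relcomp_unfold)
  qed auto
  have L_pow: "?w k \<in> L \<longleftrightarrow> (\<exists>p \<in> I. \<exists>q \<in> F. (p, q) \<in> R ^^ k)" for k
    using R_pow I unfolding L[symmetric] nfa_lang_def by blast
  have period_mult: "(?w (m * n + k), ?w k) \<in> syn_rel L" for m k
  proof (induction m)
    case (Suc m)
    have "(?w n @ ?w (m * n + k), [] @ ?w k) \<in> syn_rel L"
      using period Suc by (rule syn_rel_append)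
    then show ?case by (simp flip: word_pow_add add: ac_simps)
  qed simp
  have "?w (k + n) \<in> L \<longleftrightarrow> ?w k \<in> L" for k
    using syn_rel_mem[OF period_mult[of 1 k]] by (simp add: add.commute)
  then obtain D where finD: "finite D" and D0: "0 \<notin> D" and sumD: "\<Sum>D \<le> card Q"
    and D: "\<And>a. ?w a \<in> L \<Longrightarrow> \<exists>c \<in> D. \<forall>k. ?w (a + k * c) \<in> L"
    using periodic_unary_nfa_cycles[OF fin R I n, of "\<lambda>k. ?w k \<in> L" F] L_pow by blast
  \<comment> \<open>The largest sublanguage of \<open>L\<close> invariant under \<open>w\<^sup>c\<close>.\<close>
  define M where "M c = {x. \<forall>k. ?w (k * c) @ x \<in> L}" for c
  have M_sat: "y \<in> M c" if "x \<in> M c" "(x, y) \<in> syn_rel L" for x y c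
    using that syn_rel_mem[OF syn_rel_append[OF syn_rel_refl that(2)]] by (simp add: M_def)
  have M_shift: "lder (?w c) (M c) = M c" for c
  proof (intro equalityI subsetI)
    fix x assume x: "x \<in> lder (?w c) (M c)"
    \<comment> \<open>To cancel \<open>w\<close> to the power \<open>c\<close>, its power
      \<open>n - 1\<close> is used as an inverse: the exponents \<open>(k + n - 1) * c\<close> and
      \<open>c\<close> add up to \<open>k * c\<close> plus a multiple of \<open>n\<close>.\<close>
    have "?w (k * c) @ x \<in> L" for k
    proof -
      have "?w ((k + n - 1) * c) @ ?w c @ x \<in> L" using x by (simp add: lder_def M_def)
      also have "?w ((k + n - 1) * c) @ ?w c @ x = ?w (c * n + k * c) @ x"
      proof -
        have "(k + n - 1) * c + c = c * n + k * c" using n by (cases n) (auto simp: algebra_simps)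
        then show ?thesis by (metis append.assoc word_pow_add)
      qed
      finally show ?thesis
        using syn_rel_mem[OF syn_rel_append[OF period_mult syn_rel_refl]] by blast
    qed
    then show "x \<in> M c" by (simp add: M_def)
  next
    fix x assume x: "x \<in> M c"
    have "?w (k * c) @ ?w c @ x \<in> L" for k
    proof -
      have "?w (Suc k * c) @ x \<in> L" using x unfolding M_def by blast
      moreover have "?w (Suc k * c) = ?w (k * c) @ ?w c" by (simp flip: word_pow_add add: ac_simps)
      ultimately show ?thesis by simp
    qed
    then show "x \<in> lder (?w c) (M c)" by (simp add: lder_def M_def)
  qed
  have M_mod: "lder (?w m) (M c) = lder (?w (m mod c)) (M c)" for m c
  proof -
    have "lder (?w (k * c)) (M c) = M c" for k
      by (induction k) (simp_all add: word_pow_add lder_append M_shift)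
    then have "lder (?w ((m div c) * c + m mod c)) (M c) = lder (?w (m mod c)) (M c)"
      by (simp only: word_pow_add lder_append)
    then show ?thesis by simp
  qed
  define B where "B = (\<lambda>(c, j). lder (?w j) (M c)) ` Sigma D (\<lambda>c. {..<c})"
  have BI: "lder (?w m) (M c) \<in> B" if "c \<in> D" for m c
  proof -
    \<comment> \<open>As \<open>0\<close> is not in \<open>D\<close>, reduction modulo
      \<open>c\<close> yields an index in the range used for \<open>B\<close>.\<close>
    have "m mod c < c" using that D0 by (cases c) auto
    with that show ?thesis by (subst M_mod) (force simp: B_def)
  qed
  have finB: "finite B" using finD by (simp add: B_def)
  have "card B \<le> card (Sigma D (\<lambda>c. {..<c}))" unfolding B_def using finD by (intro card_image_le) simp
  also have "\<dots> = \<Sum>D" using finD by simp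
  finally have cardB: "card B \<le> card Q" using sumD by simp
  have sat: "y \<in> K" if "K \<in> B" "(x, y) \<in> syn_rel L" "x \<in> K" for K x y
    using that M_sat[OF _ syn_rel_append[OF syn_rel_refl that(2)]] by (auto simp: B_def lder_def)
  have der: "lder u K \<in> B" if K: "K \<in> B" for K u
  proof -
    obtain c j where cj: "c \<in> D" "K = lder (?w j) (M c)" using K by (auto simp: B_def)
    obtain m where m: "(?w j @ u, ?w m) \<in> syn_rel L" using gen by blast
    have "lder u K = lder (?w j @ u) (M c)" by (simp add: cj lder_append)
    also have "\<dots> = lder (?w m) (M c)"
      unfolding lder_def
      using M_sat[OF _ syn_rel_append[OF m syn_rel_refl]]
        M_sat[OF _ syn_rel_append[OF syn_rel_sym[OF m] syn_rel_refl]] by blast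
    finally show ?thesis using BI cj by simp
  qed
  have "M c \<in> B" if "c \<in> D" for c using BI[OF that, of 0] by simp
  moreover have "L = \<Union>(M ` D)"
  proof
    show "L \<subseteq> \<Union>(M ` D)"
    proof
      fix x assume x: "x \<in> L"
      obtain a where a: "(x, ?w a) \<in> syn_rel L" using gen by blast
      then have "?w a \<in> L" using x syn_rel_mem by blast
      then obtain c where c: "c \<in> D" "\<And>k. ?w (a + k * c) \<in> L" using D by blast
      \<comment> \<open>Replacing \<open>x\<close> by the equivalent power \<open>a\<close> of
        \<open>w\<close> turns this into acceptance of the exponent \<open>a + k * c\<close>, which
        is the choice of \<open>c\<close>.\<close>
      have "?w (k * c) @ x \<in> L" for k
        using c(2)[of k] syn_rel_mem[OF syn_rel_append[OF syn_rel_refl[of "?w (k * c)"] a]]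
        by (simp add: add.commute flip: word_pow_add)
      then show "x \<in> \<Union>(M ` D)" using c by (auto simp: M_def)
    qed
    \<comment> \<open>The instance \<open>k = 0\<close> of membership in \<open>M c\<close>.\<close>
    have "x \<in> L" if "x \<in> M c" for x c
      using that[unfolded M_def, simplified, THEN spec[of _ 0]] by simp
    then show "\<Union>(M ` D) \<subseteq> L" by blast
  qed
  ultimately have "\<exists>U \<subseteq> B. L = \<Union>U" by (intro exI[of _ "M ` D"]) auto
  then show thesis using that finB cardB sat der by blast
qed

theorem theorem5p2:
  fixes L :: "('a :: finite) list set"
  assumes "regular L"
    and "group (syn_monoid L)"
    and "cyclic_group (syn_monoid L)"
  shows "ns L = nsyn L"
proof -
  let ?P = "\<lambda>n. \<exists>(Q :: nat set) I F \<delta>. is_nfa Q I F \<delta> \<and> nfa_lang I F \<delta> = L \<and> card Q = n"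
  let ?R = "\<lambda>n. \<exists>(S :: nat set) jn bt \<rho>. fin_jsl S jn bt \<and> bool_rep L S jn bt \<rho>
      \<and> extends_canonical L S jn bt \<rho> \<and> card (join_irr S jn bt) = n"
  obtain w n where w: "0 < n" "(word_pow w n, []) \<in> syn_rel L"
    "\<And>x. \<exists>k. (x, word_pow w k) \<in> syn_rel L"
    using cyclic_syn_monoid_generator[OF finite_syn_monoid[OF assms(1)] assms(2,3)] by metis
  have "\<exists>n. ?P n" using assms(1) by (auto simp: regular_def)
  then have "?P (ns L)" unfolding ns_def by (rule LeastI_ex)
  then obtain Q :: "nat set" and I F \<delta> where Q: "is_nfa Q I F \<delta>" "nfa_lang I F \<delta> = L" "card Q = ns L"
    by blast
  obtain B where B: "finite B" "card B \<le> card Q"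
    "\<And>K x y. K \<in> B \<Longrightarrow> (x, y) \<in> syn_rel L \<Longrightarrow> x \<in> K \<Longrightarrow> y \<in> K"
    "\<And>K u. K \<in> B \<Longrightarrow> lder u K \<in> B" "\<exists>U \<subseteq> B. L = \<Union>U"
    using derivative_family_of_nfa[OF w Q(1,2)] by metis
  have "\<exists>(S :: nat set) jn bt \<rho>. fin_jsl S jn bt \<and> bool_rep L S jn bt \<rho>
      \<and> extends_canonical L S jn bt \<rho> \<and> card (join_irr S jn bt) \<le> card B"
    by (rule bool_rep_of_derivative_family) (fact B)+
  then obtain m where m: "?R m" "m \<le> card B" by metis
  \<comment> \<open>One inequality follows from \<open>m \<le> card B \<le> card Q = ns L\<close>.
    The same \<open>m\<close> shows that the minimum defining \<open>nsyn\<close> is attained, and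
    the nfa on the join-irreducibles of an optimal representation gives the other.\<close>
  have "nsyn L \<le> m" unfolding nsyn_def using m(1) by (rule Least_le)
  moreover have "?R (nsyn L)" unfolding nsyn_def using m(1) by (rule LeastI)
  then obtain S :: "nat set" and jn bt \<rho> where "fin_jsl S jn bt" "bool_rep L S jn bt \<rho>"
      "extends_canonical L S jn bt \<rho>" and card: "card (join_irr S jn bt) = nsyn L"
    by (elim exE conjE)
  then have "?P (nsyn L)" using nfa_of_bool_rep[of S jn bt L \<rho>] card by metis
  then have "ns L \<le> nsyn L" unfolding ns_def by (rule Least_le)
  ultimately show ?thesis using m(2) B(2) Q(3) by simp
qed

end
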